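(* Let $v$ be a positive integer and consider any $\mathrm{BIBD}(v,4,1)$. Maker (the first player) has a winning strategy in the Maker-Breaker game on it if and only if $v\equiv 1,4 \pmod{12}$ and $v>13$ (so Breaker has a winning strategy on this design for $v\in\{4,13\}$).
   Context: A $\mathrm{BIBD}(v,k,\lambda)$ is a pair $(X,\mathcal{B})$ where $X$ is a set of $v$ points and $\mathcal{B}$ is a collection of $k$-element subsets of $X$ (blocks) such that every pair of distinct points of $X$ occurs in exactly $\lambda$ blocks. The case $v=k$ is allowed. The Maker-Breaker game on a design: Maker and Breaker alternately choose points not chosen before, Maker moving first. Maker wins if he at some time has chosen all points of some block; Breaker wins if all points have been chosen and Maker has not completed a block. *)

theory Defs
  imports Main
begin

text \<open>
  The blocks form a set rather than a multiset. For \<open>k \<ge> 2\<close> and \<open>\<lambda> = 1\<close> this is no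
  restriction, as a repeated block would cover its pairs of points at least twice.
  A set of at most \<open>1\<close> point with no blocks is admitted, and so is \<open>v = k\<close>.
\<close>

definition BIBD :: "nat \<Rightarrow> nat \<Rightarrow> nat \<Rightarrow> 'a set \<Rightarrow> 'a set set \<Rightarrow> bool" where
  "BIBD v k l X Bs \<longleftrightarrow>
     finite X \<and> card X = v \<and>
     (\<forall>B\<in>Bs. B \<subseteq> X \<and> card B = k) \<and>
     (\<forall>x\<in>X. \<forall>y\<in>X. x \<noteq> y \<longrightarrow> card {B \<in> Bs. x \<in> B \<and> y \<in> B} = l)"

text \<open>
  A history lists the points chosen so far in the order of the moves. Maker makes the moves
  with even index (counting from \<open>0\<close>), Breaker those with odd index. A play goes on until all
  points are chosen, even if Maker has completed a block before that.
\<close>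

definition history :: "'a set \<Rightarrow> 'a list \<Rightarrow> bool" where
  "history X h \<longleftrightarrow> distinct h \<and> set h \<subseteq> X"

definition complete_play :: "'a set \<Rightarrow> 'a list \<Rightarrow> bool" where
  "complete_play X h \<longleftrightarrow> history X h \<and> set h = X"

definition maker_points :: "'a list \<Rightarrow> 'a set" where
  "maker_points h = {h ! i | i. i < length h \<and> even i}"

definition maker_wins_play :: "'a set set \<Rightarrow> 'a list \<Rightarrow> bool" where
  "maker_wins_play Bs h \<longleftrightarrow> (\<exists>n\<le>length h. \<exists>B\<in>Bs. B \<subseteq> maker_points (take n h))"

definition breaker_wins_play :: "'a set set \<Rightarrow> 'a list \<Rightarrow> bool" where
  "breaker_wins_play Bs h \<longleftrightarrow> \<not> maker_wins_play Bs h"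

text \<open>
  A strategy maps histories to the next move; \<open>T n\<close> says that the owner of the strategy makes
  the move with index \<open>n\<close>. The legality condition rules out that a strategy wins vacuously
  because no complete play follows it.
\<close>

definition legal_strategy :: "'a set \<Rightarrow> (nat \<Rightarrow> bool) \<Rightarrow> ('a list \<Rightarrow> 'a) \<Rightarrow> bool" where
  "legal_strategy X T s \<longleftrightarrow>
     (\<forall>h. history X h \<and> set h \<noteq> X \<and> T (length h) \<longrightarrow> s h \<in> X - set h)"

definition follows :: "(nat \<Rightarrow> bool) \<Rightarrow> ('a list \<Rightarrow> 'a) \<Rightarrow> 'a list \<Rightarrow> bool" where
  "follows T s h \<longleftrightarrow> (\<forall>i<length h. T i \<longrightarrow> h ! i = s (take i h))"

definition maker_has_winning_strategy :: "'a set \<Rightarrow> 'a set set \<Rightarrow> bool" where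
  "maker_has_winning_strategy X Bs \<longleftrightarrow>
     (\<exists>s. legal_strategy X even s \<and>
          (\<forall>h. complete_play X h \<and> follows even s h \<longrightarrow> maker_wins_play Bs h))"

definition breaker_has_winning_strategy :: "'a set \<Rightarrow> 'a set set \<Rightarrow> bool" where
  "breaker_has_winning_strategy X Bs \<longleftrightarrow>
     (\<exists>s. legal_strategy X odd s \<and>
          (\<forall>h. complete_play X h \<and> follows odd s h \<longrightarrow> breaker_wins_play Bs h))"

end

(*
  For v >= 25 Maker wins with Beck's potential: a block free of Breaker's points has weight
  2^(number of Maker's points on it). If Maker always takes a point through which the total
  weight is largest, a round costs at most 4, namely the weight of the only block that can
  contain both points of the round. There are v(v-1)/12 blocks, too many to be exhausted.

  For v <= 13 Breaker uses the Erdos-Selfridge strategy for the same weights, which wins once the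
  total weight is below 16 with Breaker to move. For v = 13 he gets there after at most two
  replies, the second one on the line through Maker's first two points.

  For v = 16 the design is an affine plane of order 4. Two parallel classes give a 4 x 4 grid, and
  after a relabelling of the rows the remaining blocks are the graphs of the even permutations.
  So the plane is unique, and Maker wins on it by at most three free moves after the opening,
  followed by at most four forcing moves.
*)
theory Submission
  imports Defs
begin

section \<open>Positions and strategies\<close>

text \<open>
  \<open>M\<close> and \<open>N\<close> are the points of Maker and Breaker. Maker is to move in \<open>maker_wins_from\<close>,
  Breaker in \<open>breaker_wins_from\<close>.
\<close>

inductive maker_wins_from :: "'a set \<Rightarrow> 'a set set \<Rightarrow> 'a set \<Rightarrow> 'a set \<Rightarrow> bool"
  for X Bs where
  full: "B \<in> Bs \<Longrightarrow> B \<subseteq> M \<Longrightarrow> maker_wins_from X Bs M N"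
| move: "x \<in> X - M - N \<Longrightarrow>
    (X - insert x M - N = {} \<Longrightarrow> \<exists>B\<in>Bs. B \<subseteq> insert x M) \<Longrightarrow>
    (\<And>y. y \<in> X - insert x M - N \<Longrightarrow> maker_wins_from X Bs (insert x M) (insert y N)) \<Longrightarrow>
    maker_wins_from X Bs M N"

inductive breaker_wins_from :: "'a set \<Rightarrow> 'a set set \<Rightarrow> 'a set \<Rightarrow> 'a set \<Rightarrow> bool"
  for X Bs where
  exhausted: "\<forall>B\<in>Bs. \<not> B \<subseteq> M \<Longrightarrow> X - M - N = {} \<Longrightarrow> breaker_wins_from X Bs M N"
| move: "\<forall>B\<in>Bs. \<not> B \<subseteq> M \<Longrightarrow> y \<in> X - M - N \<Longrightarrow>
    (\<And>x. x \<in> X - M - insert y N \<Longrightarrow> breaker_wins_from X Bs (insert x M) (insert y N)) \<Longrightarrow>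
    breaker_wins_from X Bs M N"

section \<open>From winning positions to strategies for complete plays\<close>

definition owned :: "(nat \<Rightarrow> bool) \<Rightarrow> 'a list \<Rightarrow> 'a set" where
  "owned T h = (!) h ` {i. i < length h \<and> T i}"

lemma maker_points_eq_owned: "maker_points h = owned even h"
  by (auto simp: maker_points_def owned_def)

lemma owned_Nil [simp]: "owned T [] = {}"
  by (simp add: owned_def)

lemma owned_snoc:
  "owned T (h @ [x]) = (if T (length h) then insert x (owned T h) else owned T h)"
proof -
  have "{i. i < length (h @ [x]) \<and> T i} =
      (if T (length h) then insert (length h) {i. i < length h \<and> T i}
       else {i. i < length h \<and> T i})"
    by (auto simp: less_Suc_eq)
  moreover have "(!) (h @ [x]) ` {i. i < length h \<and> T i} = owned T h"
    unfolding owned_def by (intro image_cong) (auto simp: nth_append)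
  ultimately show ?thesis
    unfolding owned_def by simp
qed

lemma owned_take_Suc:
  "n < length h \<Longrightarrow>
    owned T (take (Suc n) h) =
      (if T n then insert (h ! n) (owned T (take n h)) else owned T (take n h))"
  by (simp add: take_Suc_conv_app_nth owned_snoc)

lemma owned_take_subset: "owned T (take n h) \<subseteq> owned T h"
  by (auto simp: owned_def)

lemma owned_even_Un_odd: "owned even h \<union> owned odd h = set h"
  unfolding owned_def set_conv_nth by blast

text \<open>Maker's points only grow along a play, so a block completed at some time is still
  complete in the final position.\<close>

lemma maker_wins_play_iff: "maker_wins_play Bs h \<longleftrightarrow> (\<exists>B\<in>Bs. B \<subseteq> owned even h)"
  unfolding maker_wins_play_def maker_points_eq_owned
  by (metis order.trans order_refl owned_take_subset take_all)

lemma history_take: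
  assumes "history X h" "n < length h"
  shows "history X (take n h)" "h ! n \<in> X - set (take n h)" "set (take n h) \<noteq> X"
proof -
  have "distinct (take n h @ [h ! n])"
    using assms by (metis distinct_take history_def take_Suc_conv_app_nth)
  then show "h ! n \<in> X - set (take n h)"
    using assms by (auto simp: history_def)
  then show "set (take n h) \<noteq> X"
    by blast
  show "history X (take n h)"
    using assms set_take_subset[of n h] by (auto simp: history_def)
qed

text \<open>A derivation of \<open>maker_wins_from\<close> becomes a function on histories by
  choosing, in each position, a point that the rule \<open>move\<close> admits. The invariant is
  maintained at the even times, when Maker is to move.\<close>

lemma maker_has_winning_strategyI:
  assumes start: "maker_wins_from X Bs {} {}"
  shows "maker_has_winning_strategy X Bs"
proof -
  define good where "good M N x \<longleftrightarrow> x \<in> X - M - N \<and>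
      (X - insert x M - N = {} \<longrightarrow> (\<exists>B\<in>Bs. B \<subseteq> insert x M)) \<and>
      (\<forall>y\<in>X - insert x M - N. maker_wins_from X Bs (insert x M) (insert y N))" for M N x
  have good: "\<exists>x. good M N x" if "maker_wins_from X Bs M N" "\<not> (\<exists>B\<in>Bs. B \<subseteq> M)" for M N
    using that unfolding good_def by (cases rule: maker_wins_from.cases) blast+
  \<comment> \<open>Where no good point exists, the choice falls back on an arbitrary free point;
    this keeps the strategy legal on every history.\<close>
  define pick where "pick h = (SOME x. x \<in> X - set h \<and>
      ((\<exists>x. good (owned even h) (owned odd h) x) \<longrightarrow> good (owned even h) (owned odd h) x))" for h
  have pick: "pick h \<in> X - set h \<and>
      ((\<exists>x. good (owned even h) (owned odd h) x) \<longrightarrow> good (owned even h) (owned odd h) (pick h))"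
    if "history X h" "set h \<noteq> X" for h
  proof -
    have "\<exists>x. x \<in> X - set h \<and>
      ((\<exists>x. good (owned even h) (owned odd h) x) \<longrightarrow> good (owned even h) (owned odd h) x)"
    proof (cases "\<exists>x. good (owned even h) (owned odd h) x")
      case True
      then show ?thesis
        unfolding good_def owned_even_Un_odd[of h, symmetric] by blast
    next
      case False
      then show ?thesis
        using that by (auto simp: history_def)
    qed
    then show ?thesis
      unfolding pick_def by (rule someI_ex)
  qed
  have "maker_wins_play Bs h" if h: "complete_play X h" "follows even pick h" for h
  proof (rule ccontr)
    assume lost: "\<not> maker_wins_play Bs h"
    let ?M = "\<lambda>n. owned even (take n h)" and ?N = "\<lambda>n. owned odd (take n h)"
    have hist: "history X h" and all: "set h = X"
      using h by (auto simp: complete_play_def)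
    have not_full: "\<not> (\<exists>B\<in>Bs. B \<subseteq> ?M n)" for n
      using lost owned_take_subset[of even n h] unfolding maker_wins_play_iff by blast
    have step: "good (?M n) (?N n) (h ! n)"
      if "n < length h" "even n" "maker_wins_from X Bs (?M n) (?N n)" for n
      using pick[OF history_take(1,3)[OF hist that(1)]] good[OF that(3) not_full] h(2) that(1,2)
      by (auto simp: follows_def)
    have inv: "2 * k \<le> length h \<Longrightarrow> maker_wins_from X Bs (?M (2 * k)) (?N (2 * k))" for k
    proof (induction k)
      case 0
      then show ?case using start by simp
    next
      case (Suc k)
      have "h ! Suc (2 * k) \<in> X - set (take (Suc (2 * k)) h)"
        using history_take(2)[OF hist, of "Suc (2 * k)"] Suc.prems by simp
      then have "h ! Suc (2 * k) \<in> X - ?M (Suc (2 * k)) - ?N (Suc (2 * k))"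
        using owned_even_Un_odd[of "take (Suc (2 * k)) h"] by blast
      then show ?case
        using step[of "2 * k"] Suc by (simp add: owned_take_Suc good_def)
    qed
    define k where "k = length h div 2"
    show False
    \<comment> \<open>After an even number of moves Maker would be to move on a full board, where no
      good point exists. After an odd number Maker has moved last, and the premise of
      \<open>move\<close> for an exhausted board yields the block.\<close>
    proof (cases "even (length h)")
      case True
      then have "maker_wins_from X Bs (owned even h) (owned odd h)"
        using inv[of k] by (simp add: k_def)
      then obtain x where "good (owned even h) (owned odd h) x"
        using good[of "owned even h" "owned odd h"] not_full[of "length h"] by auto
      then have "x \<in> X - owned even h - owned odd h"
        by (simp add: good_def)
      then show False
        using owned_even_Un_odd[of h] all by blast
    next
      case False
      then have k: "length h = Suc (2 * k)"
        by (simp add: k_def)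
      let ?x = "h ! (2 * k)"
      have last: "owned even h = insert ?x (?M (2 * k))" "owned odd h = ?N (2 * k)"
        using owned_take_Suc[of "2 * k" h even] owned_take_Suc[of "2 * k" h odd] k by simp_all
      have "good (?M (2 * k)) (?N (2 * k)) ?x"
        using step[of "2 * k"] inv[of k] k by simp
      moreover have "X - insert ?x (?M (2 * k)) - ?N (2 * k) = {}"
        using owned_even_Un_odd[of h] all unfolding last by blast
      ultimately have "\<exists>B\<in>Bs. B \<subseteq> owned even h"
        unfolding good_def last by (elim conjE mp)
      then show False
        using lost by (simp add: maker_wins_play_iff)
    qed
  qed
  moreover have "legal_strategy X even pick"
    unfolding legal_strategy_def using pick by blast
  ultimately show ?thesis
    unfolding maker_has_winning_strategy_def by blast
qed

text \<open>Dual to the construction for Maker, with the invariant at the odd times; Breaker's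
  analysis therefore starts after each possible first move of Maker.\<close>

lemma breaker_has_winning_strategyI:
  assumes "X \<noteq> {}"
    and start: "\<And>x. x \<in> X \<Longrightarrow> breaker_wins_from X Bs {x} {}"
  shows "breaker_has_winning_strategy X Bs"
proof -
  define good where "good M N y \<longleftrightarrow> y \<in> X - M - N \<and>
      (\<forall>x\<in>X - M - insert y N. breaker_wins_from X Bs (insert x M) (insert y N))" for M N y
  have good: "\<exists>y. good M N y" if "breaker_wins_from X Bs M N" "X - M - N \<noteq> {}" for M N
    using that unfolding good_def by (cases rule: breaker_wins_from.cases) blast+
  define pick where "pick h = (SOME y. y \<in> X - set h \<and>
      ((\<exists>y. good (owned even h) (owned odd h) y) \<longrightarrow> good (owned even h) (owned odd h) y))" for h
  have pick: "pick h \<in> X - set h \<and>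
      ((\<exists>y. good (owned even h) (owned odd h) y) \<longrightarrow> good (owned even h) (owned odd h) (pick h))"
    if "history X h" "set h \<noteq> X" for h
  proof -
    have "\<exists>y. y \<in> X - set h \<and>
      ((\<exists>y. good (owned even h) (owned odd h) y) \<longrightarrow> good (owned even h) (owned odd h) y)"
    proof (cases "\<exists>y. good (owned even h) (owned odd h) y")
      case True
      then show ?thesis
        unfolding good_def owned_even_Un_odd[of h, symmetric] by blast
    next
      case False
      then show ?thesis
        using that by (auto simp: history_def)
    qed
    then show ?thesis
      unfolding pick_def by (rule someI_ex)
  qed
  have "breaker_wins_play Bs h" if h: "complete_play X h" "follows odd pick h" for h
  proof -
    let ?M = "\<lambda>n. owned even (take n h)" and ?N = "\<lambda>n. owned odd (take n h)"
    have hist: "history X h" and all: "set h = X"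
      using h by (auto simp: complete_play_def)
    have inv: "2 * k < length h \<Longrightarrow>
        breaker_wins_from X Bs (?M (Suc (2 * k))) (?N (Suc (2 * k)))" for k
    proof (induction k)
      case 0
      then have "h ! 0 \<in> X"
        using all nth_mem[of 0 h] by auto
      then show ?case
        using start 0 by (simp add: owned_take_Suc)
    next
      case (Suc k)
      let ?n = "Suc (2 * k)"
      have n: "?n < length h" "Suc ?n < length h"
        using Suc.prems by auto
      have fresh: "h ! ?n \<in> X - ?M ?n - ?N ?n" "h ! Suc ?n \<in> X - ?M (Suc ?n) - ?N (Suc ?n)"
        using history_take(2)[OF hist n(1)] history_take(2)[OF hist n(2)]
          owned_even_Un_odd[of "take ?n h"] owned_even_Un_odd[of "take (Suc ?n) h"] by blast+
      then have "\<exists>y. good (?M ?n) (?N ?n) y"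
        using good[of "?M ?n" "?N ?n"] Suc by auto
      then have "good (?M ?n) (?N ?n) (h ! ?n)"
        using pick[OF history_take(1,3)[OF hist n(1)]] h(2) n(1) by (auto simp: follows_def)
      then show ?case
        using fresh n by (simp add: owned_take_Suc good_def)
    qed
    \<comment> \<open>Maker's last move has index \<open>2 * k\<close>; a reply of Breaker after it
      leaves Maker's points unchanged.\<close>
    define k where "k = (length h - 1) div 2"
    have "length h > 0"
      using all \<open>X \<noteq> {}\<close> by auto
    then have k: "length h = Suc (2 * k) \<or> length h = Suc (Suc (2 * k))"
      unfolding k_def by presburger
    then have "owned even h = ?M (Suc (2 * k))"
      using owned_take_Suc[of "Suc (2 * k)" h even] by auto
    moreover have "breaker_wins_from X Bs (?M (Suc (2 * k))) (?N (Suc (2 * k)))"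
      using inv[of k] k by auto
    then have "\<forall>B\<in>Bs. \<not> B \<subseteq> ?M (Suc (2 * k))"
      by (cases rule: breaker_wins_from.cases) assumption+
    ultimately show ?thesis
      unfolding breaker_wins_play_def maker_wins_play_iff by simp
  qed
  moreover have "legal_strategy X odd pick"
    unfolding legal_strategy_def using pick by blast
  ultimately show ?thesis
    unfolding breaker_has_winning_strategy_def by blast
qed

text \<open>The two strategies are played against each other; legality extends every shorter play
  until the board is full. This turns a win of Breaker into the absence of a winning strategy for
  Maker.\<close>

lemma not_both_winning_strategies:
  assumes "finite X" "maker_has_winning_strategy X Bs" "breaker_has_winning_strategy X Bs"
  shows False
proof -
  obtain s where s: "legal_strategy X even s"
    "\<And>h. complete_play X h \<Longrightarrow> follows even s h \<Longrightarrow> maker_wins_play Bs h"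
    using assms(2) unfolding maker_has_winning_strategy_def by blast
  obtain t where t: "legal_strategy X odd t"
    "\<And>h. complete_play X h \<Longrightarrow> follows odd t h \<Longrightarrow> breaker_wins_play Bs h"
    using assms(3) unfolding breaker_has_winning_strategy_def by blast
  have "n \<le> card X \<Longrightarrow> \<exists>h. history X h \<and> length h = n \<and> follows even s h \<and> follows odd t h" for n
  proof (induction n)
    case 0
    then show ?case by (auto simp: history_def follows_def)
  next
    case (Suc n)
    then obtain h where h: "history X h" "length h = n" "follows even s h" "follows odd t h"
      by auto
    have "set h \<noteq> X"
      using h(1,2) Suc.prems by (metis Suc_n_not_le_n distinct_card history_def)
    then have "\<exists>x\<in>X - set h. (even n \<longrightarrow> x = s h) \<and> (odd n \<longrightarrow> x = t h)"
      using s(1) t(1) h(1,2) unfolding legal_strategy_def by (cases "even n") auto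
    then obtain x where "x \<in> X - set h" "even n \<longrightarrow> x = s h" "odd n \<longrightarrow> x = t h"
      by blast
    then have "history X (h @ [x]) \<and> length (h @ [x]) = Suc n
        \<and> follows even s (h @ [x]) \<and> follows odd t (h @ [x])"
      using h by (auto simp: history_def follows_def nth_append less_Suc_eq)
    then show ?case by blast
  qed
  then obtain h where h: "history X h" "length h = card X" "follows even s h" "follows odd t h"
    by blast
  then have "complete_play X h"
    using assms(1) by (metis card_subset_eq complete_play_def distinct_card history_def)
  then show False
    using s(2) t(2) h(3,4) unfolding breaker_wins_play_def by blast
qed

section \<open>Potentials\<close>

lemma finite_ex_maximizer:
  fixes f :: "'a \<Rightarrow> 'b::linorder"
  assumes "finite S" "S \<noteq> {}"
  shows "\<exists>x\<in>S. \<forall>y\<in>S. f y \<le> f x"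
proof -
  have "Max (f ` S) \<in> f ` S"
    using assms by (intro Max_in) auto
  then obtain x where "x \<in> S" "f x = Max (f ` S)"
    by auto
  then show ?thesis
    using assms(1) by (metis Max_ge finite_imageI imageI)
qed

section \<open>Block weights and their change during a round\<close>

definition live :: "'a set set \<Rightarrow> 'a set \<Rightarrow> 'a set set" where
  "live Bs N = {B \<in> Bs. B \<inter> N = {}}"

definition potential :: "'a set set \<Rightarrow> 'a set \<Rightarrow> 'a set \<Rightarrow> nat" where
  "potential Bs M N = (\<Sum>B\<in>live Bs N. 2 ^ card (B \<inter> M))"

definition potential_at :: "'a set set \<Rightarrow> 'a set \<Rightarrow> 'a set \<Rightarrow> 'a \<Rightarrow> nat" where
  "potential_at Bs M N x = (\<Sum>B\<in>{B \<in> live Bs N. x \<in> B}. 2 ^ card (B \<inter> M))"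

text \<open>A linear space with lines of size four: the pair count 1 of the design is split into
  existence and uniqueness of the joining block.\<close>

locale four_uniform_linear =
  fixes X :: "'a set" and Bs :: "'a set set"
  assumes finite_points: "finite X"
    and block_subset: "B \<in> Bs \<Longrightarrow> B \<subseteq> X"
    and card_block: "B \<in> Bs \<Longrightarrow> card B = 4"
    and line_ex: "x \<in> X \<Longrightarrow> y \<in> X \<Longrightarrow> x \<noteq> y \<Longrightarrow> \<exists>B\<in>Bs. x \<in> B \<and> y \<in> B"
    and line_unique: "B \<in> Bs \<Longrightarrow> C \<in> Bs \<Longrightarrow> x \<noteq> y \<Longrightarrow> x \<in> B \<Longrightarrow> y \<in> B \<Longrightarrow> x \<in> C \<Longrightarrow> y \<in> C \<Longrightarrow> B = C"
begin

lemma finite_blocks: "finite Bs"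
  using finite_points block_subset by (meson finite_Pow_iff finite_subset PowI subsetI)

lemma finite_block: "B \<in> Bs \<Longrightarrow> finite B"
  using finite_points block_subset finite_subset by blast

lemma finite_live: "finite (live Bs N)"
  using finite_blocks by (simp add: live_def)

lemma potential_remove:
  "potential Bs M N = potential Bs M (insert y N) + potential_at Bs M N y"
proof -
  have "live Bs N = live Bs (insert y N) \<union> {B \<in> live Bs N. y \<in> B}"
    by (auto simp: live_def)
  moreover have "live Bs (insert y N) \<inter> {B \<in> live Bs N. y \<in> B} = {}"
    by (auto simp: live_def)
  ultimately show ?thesis
    unfolding potential_def potential_at_def
    using sum.union_disjoint[of "live Bs (insert y N)" "{B \<in> live Bs N. y \<in> B}"] finite_live by simp
qed

lemma potential_insert:
  assumes "x \<notin> M"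
  shows "potential Bs (insert x M) N = potential Bs M N + potential_at Bs M N x"
proof -
  have "2 ^ card (B \<inter> insert x M) = 2 ^ card (B \<inter> M) + (if x \<in> B then 2 ^ card (B \<inter> M) else (0::nat))"
    if "B \<in> live Bs N" for B
  proof -
    have "finite (B \<inter> M)"
      using that finite_block by (auto simp: live_def)
    then show ?thesis
      using assms by (cases "x \<in> B") (auto simp: Int_insert_right)
  qed
  then have "potential Bs (insert x M) N =
      (\<Sum>B\<in>live Bs N. 2 ^ card (B \<inter> M) + (if x \<in> B then 2 ^ card (B \<inter> M) else 0))"
    unfolding potential_def by (intro sum.cong) auto
  then show ?thesis
    unfolding potential_def potential_at_def using finite_live
    by (simp add: sum.distrib sum.inter_filter)
qed

definition potential_common :: "'a set \<Rightarrow> 'a set \<Rightarrow> 'a \<Rightarrow> 'a \<Rightarrow> nat" where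
  "potential_common M N x y = (\<Sum>B\<in>{B \<in> live Bs N. x \<in> B \<and> y \<in> B}. 2 ^ card (B \<inter> M))"

lemma potential_at_remove:
  "potential_at Bs M N x = potential_at Bs M (insert y N) x + potential_common M N x y"
proof -
  let ?A = "{B \<in> live Bs (insert y N). x \<in> B}" and ?C = "{B \<in> live Bs N. x \<in> B \<and> y \<in> B}"
  have "{B \<in> live Bs N. x \<in> B} = ?A \<union> ?C" "?A \<inter> ?C = {}"
    by (auto simp: live_def)
  then show ?thesis
    unfolding potential_at_def potential_common_def
    using sum.union_disjoint[of ?A ?C] finite_live by simp
qed

text \<open>If \<open>y\<close> is placed first, \<open>x\<close> doubles only the blocks through it
  that avoid \<open>y\<close>, which accounts for the common term. The order of the two points does
  not matter for the outcome, so the identity serves both players.\<close>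

lemma potential_round:
  assumes "x \<notin> M"
  shows "potential Bs (insert x M) (insert y N) + potential_at Bs M N y + potential_common M N x y
    = potential Bs M N + potential_at Bs M N x"
  using potential_insert[OF assms, of "insert y N"] potential_remove[of M N y]
    potential_at_remove[of M N x y] by simp

text \<open>At most one block contains both points, and at most its two other points belong to
  Maker.\<close>

lemma potential_common_le:
  assumes "x \<noteq> y" "x \<notin> M" "y \<notin> M"
  shows "potential_common M N x y \<le> 4"
proof (cases "\<exists>B\<in>live Bs N. x \<in> B \<and> y \<in> B")
  case True
  then obtain B where B: "B \<in> live Bs N" "x \<in> B" "y \<in> B" by blast
  then have BBs: "B \<in> Bs"
    by (simp add: live_def)
  have "{B \<in> live Bs N. x \<in> B \<and> y \<in> B} = {B}"
    using B line_unique[OF _ BBs assms(1)] by (auto simp: live_def)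
  moreover have "card (B \<inter> M) \<le> card (B - {x, y})"
    using assms finite_block[OF BBs] by (intro card_mono) auto
  then have "card (B \<inter> M) \<le> 2"
    using B assms(1) card_block[OF BBs] by (simp add: card_Diff_subset)
  then have "(2::nat) ^ card (B \<inter> M) \<le> 2 ^ 2"
    by (intro power_increasing) auto
  ultimately show ?thesis
    by (simp add: potential_common_def)
next
  case False
  then have none: "{B \<in> live Bs N. x \<in> B \<and> y \<in> B} = {}"
    by blast
  show ?thesis
    unfolding potential_common_def none by simp
qed

text \<open>At most \<open>card (X - M - N) div 2\<close> full rounds remain and a greedy choice
  loses at most 4 in each, so the potential stays positive. A block still live on a full board is
  Maker's.\<close>

lemma maker_wins_from_potential:
  assumes "4 * (card (X - M - N) div 2) < potential Bs M N"
  shows "maker_wins_from X Bs M N"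
  using assms
proof (induction "card (X - M - N)" arbitrary: M N rule: less_induct)
  case less
  let ?U = "X - M - N"
  have finU: "finite ?U"
    using finite_points by simp
  \<comment> \<open>Positive potential provides a live block, which settles the cases where no free
    point remains before or after Maker's move.\<close>
  obtain B where B: "B \<in> Bs" "B \<inter> N = {}"
  proof (rule ccontr)
    assume "\<not> thesis"
    then have "live Bs N = {}"
      using that by (auto simp: live_def)
    then show False
      using less.prems by (simp add: potential_def)
  qed
  show ?case
  proof (cases "?U = {}")
    case True
    then have "B \<subseteq> M"
      using B block_subset[OF B(1)] by blast
    then show ?thesis
      by (rule maker_wins_from.full[OF B(1)])
  next
    case False
    obtain x where x: "x \<in> ?U" and max: "\<And>y. y \<in> ?U \<Longrightarrow> potential_at Bs M N y \<le> potential_at Bs M N x"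
      using finite_ex_maximizer[OF finU False, of "potential_at Bs M N"] by blast
    show ?thesis
    proof (rule maker_wins_from.move[OF x])
      assume "X - insert x M - N = {}"
      then show "\<exists>B\<in>Bs. B \<subseteq> insert x M"
        using B block_subset[OF B(1)] by blast
    next
      fix y assume y: "y \<in> X - insert x M - N"
      have sub: "{x, y} \<subseteq> ?U" and two: "card {x, y} = 2"
        using x y by auto
      have "X - insert x M - insert y N = ?U - {x, y}"
        by blast
      then have card: "card (X - insert x M - insert y N) = card ?U - 2"
        using sub two card_Diff_subset[of "{x, y}" ?U] by simp
      have "card ?U \<ge> 2"
        using card_mono[OF finU sub] two by simp
      show "maker_wins_from X Bs (insert x M) (insert y N)"
      proof (rule less.hyps)
        show "card (X - insert x M - insert y N) < card ?U"
          using card \<open>card ?U \<ge> 2\<close> by simp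
        have "potential Bs M N \<le> potential Bs (insert x M) (insert y N) + 4"
          using potential_round[of x M y N] potential_common_le[of x y M N] max[of y] x y by auto
        moreover have "card ?U div 2 = (card ?U - 2) div 2 + 1"
          using \<open>card ?U \<ge> 2\<close> by (simp add: le_div_geq)
        ultimately show "4 * (card (X - insert x M - insert y N) div 2)
            < potential Bs (insert x M) (insert y N)"
          using less.prems unfolding card by linarith
      qed
    qed
  qed
qed

text \<open>A completed block alone would weigh 2^4 = 16. Breaker's heaviest point \<open>y\<close>
  weighs at least as much as Maker's next point \<open>x\<close>, so no round raises the
  potential.\<close>

lemma breaker_wins_from_potential:
  assumes "potential Bs M N < 16" "M \<inter> N = {}"
  shows "breaker_wins_from X Bs M N"
  using assms
proof (induction "card (X - M - N)" arbitrary: M N rule: less_induct)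
  case less
  let ?U = "X - M - N"
  have finU: "finite ?U"
    using finite_points by simp
  have not_full: "\<forall>B\<in>Bs. \<not> B \<subseteq> M"
  proof (intro ballI notI)
    fix B assume B: "B \<in> Bs" "B \<subseteq> M"
    then have "B \<in> live Bs N" "B \<inter> M = B"
      using less.prems(2) by (auto simp: live_def)
    then have "2 ^ card B \<le> potential Bs M N"
      using member_le_sum[of B "live Bs N" "\<lambda>B. (2::nat) ^ card (B \<inter> M)"] finite_live
      by (simp add: potential_def)
    then show False
      using less.prems(1) card_block[OF B(1)] by simp
  qed
  show ?case
  proof (cases "?U = {}")
    case True
    then show ?thesis
      using not_full breaker_wins_from.exhausted by blast
  next
    case False
    obtain y where y: "y \<in> ?U" and max: "\<And>x. x \<in> ?U \<Longrightarrow> potential_at Bs M N x \<le> potential_at Bs M N y"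
      using finite_ex_maximizer[OF finU False, of "potential_at Bs M N"] by blast
    show ?thesis
    proof (rule breaker_wins_from.move[OF not_full y])
      fix x assume x: "x \<in> X - M - insert y N"
      have "X - insert x M - insert y N \<subset> ?U"
        using y by blast
      then have "card (X - insert x M - insert y N) < card ?U"
        using finU by (rule psubset_card_mono[rotated])
      moreover have "potential Bs (insert x M) (insert y N) < 16"
        using potential_round[of x M y N] max[of x] x less.prems(1) by auto
      moreover have "insert x M \<inter> insert y N = {}"
        using x y less.prems(2) by auto
      ultimately show "breaker_wins_from X Bs (insert x M) (insert y N)"
        by (rule less.hyps)
    qed
  qed
qed

section \<open>Counting blocks and the divisibility conditions\<close>

lemma card_blocks_through:
  assumes "x \<in> X"
  shows "3 * card {B \<in> Bs. x \<in> B} = card X - 1"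
proof -
  let ?Bx = "{B \<in> Bs. x \<in> B}"
  \<comment> \<open>The blocks through \<open>x\<close>, with \<open>x\<close> deleted, partition
    the other points into triples.\<close>
  have "X - {x} = (\<Union>B\<in>?Bx. B - {x})"
    using line_ex[OF assms] block_subset by blast
  moreover have "card (\<Union>B\<in>?Bx. B - {x}) = (\<Sum>B\<in>?Bx. card (B - {x}))"
    using finite_blocks finite_block line_unique by (intro card_UN_disjoint) (simp_all, blast)
  moreover have "(\<Sum>B\<in>?Bx. card (B - {x})) = (\<Sum>B\<in>?Bx. 3)"
    using card_block by (intro sum.cong) auto
  ultimately have "card (X - {x}) = 3 * card ?Bx"
    by (simp only:) simp
  then show ?thesis
    using assms finite_points by simp
qed

text \<open>Incident pairs of points and blocks are counted in two ways.\<close>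

lemma card_blocks: "12 * card Bs = card X * (card X - 1)"
proof -
  have "4 * card Bs = (\<Sum>x\<in>X. card {B \<in> Bs. x \<in> B})"
  proof (rule sum_multicount[symmetric])
    show "\<forall>B\<in>Bs. card {x \<in> X. x \<in> B} = 4"
      using card_block block_subset by (metis Collect_conj_eq Collect_mem_eq Int_absorb1)
  qed (fact finite_points finite_blocks)+
  then have "12 * card Bs = (\<Sum>x\<in>X. 3 * card {B \<in> Bs. x \<in> B})"
    by (simp add: sum_distrib_left[symmetric])
  then show ?thesis
    using card_blocks_through by simp
qed

text \<open>With \<open>r\<close> blocks through a point, 4 divides \<open>r * (3 * r + 1)\<close>;
  this excludes the residues 2 and 3 of \<open>r\<close> modulo 4.\<close>

lemma card_points_mod_12:
  assumes "X \<noteq> {}"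
  shows "card X mod 12 \<in> {1, 4}"
proof -
  obtain x where "x \<in> X"
    using assms by blast
  define r where "r = card {B \<in> Bs. x \<in> B}"
  have v: "card X = 3 * r + 1"
    using card_blocks_through[OF \<open>x \<in> X\<close>] finite_points \<open>x \<in> X\<close> card_gt_0_iff[of X]
    unfolding r_def by fastforce
  have b: "4 * card Bs = r * (3 * r + 1)"
    using card_blocks by (simp add: v)
  have "r mod 4 \<in> {0, 1}"
  proof -
    have "(r * (3 * r + 1)) mod 4 = 0"
      using b by (metis mod_mult_self1_is_0)
    then have "((r mod 4) * (3 * (r mod 4) + 1)) mod 4 = 0"
      by (metis mod_add_left_eq mod_mult_eq mod_mult_right_eq)
    moreover have "r mod 4 < 4" by simp
    then have "r mod 4 = 0 \<or> r mod 4 = 1 \<or> r mod 4 = 2 \<or> r mod 4 = 3" by linarith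
    ultimately show ?thesis by auto
  qed
  moreover define q where "q = r div 4"
  then have "r = 4 * q + r mod 4"
    by simp
  ultimately have "r = 4 * q \<or> r = 4 * q + 1"
    by (metis add_0_right insertE singletonD)
  then have "card X = 1 + 12 * q \<or> card X = 4 + 12 * q"
    unfolding v by auto
  then show ?thesis
    by (elim disjE) (simp_all only: mod_mult_self2, simp_all)
qed

lemma line_singleton:
  assumes "x \<in> X" "y \<in> X" "x \<noteq> y"
  obtains B where "B \<in> Bs" "x \<in> B" "y \<in> B" "{C \<in> Bs. x \<in> C \<and> y \<in> C} = {B}"
proof -
  obtain B where B: "B \<in> Bs" "x \<in> B" "y \<in> B"
    using line_ex[OF assms] by blast
  then have "{C \<in> Bs. x \<in> C \<and> y \<in> C} = {B}"
    using line_unique[OF _ B(1) assms(3)] by blast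
  then show ?thesis
    using that B by blast
qed

section \<open>Potential arguments from the opening\<close>

lemma potential_empty: "potential Bs {} {} = card Bs"
  by (simp add: potential_def live_def)

lemma potential_at_empty: "potential_at Bs {} {} x = card {B \<in> Bs. x \<in> B}"
  by (simp add: potential_at_def live_def)

lemma maker_wins_from_start:
  assumes "card X \<ge> 25"
  shows "maker_wins_from X Bs {} {}"
proof (rule maker_wins_from_potential)
  have "4 * (card X div 2) < card Bs"
  proof (cases "card X = 25")
    \<comment> \<open>For 25 points there are 50 blocks against 4 * 12 = 48: the rounding in
      \<open>div\<close> is essential, as 2 * 25 would be too large.\<close>
    case True
    then show ?thesis using card_blocks by simp
  next
    case False
    then have "card X * 25 \<le> card X * (card X - 1)"
      using assms by (intro mult_le_mono2) simp
    then have "25 * card X \<le> 12 * card Bs"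
      using card_blocks by (simp add: mult.commute)
    then show ?thesis using assms by linarith
  qed
  then show "4 * (card (X - {} - {}) div 2) < potential Bs {} {}"
    by (simp add: potential_empty)
qed

text \<open>There is at most one block, so the weight after the first move is at most 2.\<close>

lemma breaker_wins_from_first_move_small:
  assumes "x \<in> X" "card X \<le> 4"
  shows "breaker_wins_from X Bs {x} {}"
proof (rule breaker_wins_from_potential)
  have "card X * (card X - 1) \<le> 4 * 3"
    using assms(2) by (intro mult_le_mono) simp_all
  then have "card Bs \<le> 1"
    using card_blocks by simp
  then show "potential Bs {x} {} < 16"
    using potential_insert[of x "{}" "{}"] card_blocks_through[OF assms(1)] assms(2)
    by (simp add: potential_empty potential_at_empty)
qed simp

text \<open>
  The total weight is 17 after the first move \<open>x\<close>. After an arbitrary reply \<open>y\<close> and Maker's next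
  point \<open>m\<close> it is 15 if \<open>x\<close>, \<open>y\<close>, \<open>m\<close> are collinear and 16 otherwise, where a third point \<open>z\<close> of the
  line through \<open>x\<close> and \<open>m\<close> removes at least 6 and Maker can then add at most 5.
\<close>

lemma breaker_wins_from_first_move_13:
  assumes x: "x \<in> X" and v: "card X = 13"
  shows "breaker_wins_from X Bs {x} {}"
proof -
  have r: "card {B \<in> Bs. p \<in> B} = 4" if "p \<in> X" for p
    using card_blocks_through[OF that] v by simp
  \<comment> \<open>Four blocks pass through \<open>p\<close>, and the one joining it to
    \<open>x\<close> counts twice.\<close>
  have at_x: "potential_at Bs {x} {} p = 5" if p: "p \<in> X" "p \<noteq> x" for p
  proof -
    obtain L where L: "L \<in> Bs" "x \<in> L" "p \<in> L" "{C \<in> Bs. x \<in> C \<and> p \<in> C} = {L}"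
      using line_singleton[OF x p(1)] p(2) by auto
    have "2 ^ card (C \<inter> {x}) = (if C = L then 2 else 1::nat)" if "C \<in> {B \<in> Bs. p \<in> B}" for C
      using that L by (cases "x \<in> C") auto
    then have "potential_at Bs {x} {} p = (\<Sum>C\<in>{B \<in> Bs. p \<in> B}. if C = L then 2 else 1)"
      unfolding potential_at_def live_def by (intro sum.cong) auto
    also have "\<dots> = (\<Sum>C\<in>{B \<in> Bs. p \<in> B} - {L}. 1) + 2"
      using L finite_blocks by (subst sum.remove[of _ L]) (auto intro!: sum.cong)
    also have "\<dots> = 5"
      using L r[OF p(1)] by (simp add: card_Diff_singleton)
    finally show ?thesis .
  qed
  have small: "\<forall>B\<in>Bs. \<not> B \<subseteq> S" if "finite S" "card S < 4" for S
    using that card_mono card_block by (metis leD)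
  have "\<exists>y\<in>X. y \<noteq> x"
    using v card_mono[of "{x}" X] by force
  then obtain y where y: "y \<in> X" "y \<noteq> x"
    by blast
  show ?thesis
  proof (rule breaker_wins_from.move)
    show "y \<in> X - {x} - {}"
      using y by simp
    fix m assume "m \<in> X - {x} - {y}"
    then have m: "m \<in> X" "m \<noteq> x" "m \<noteq> y"
      by auto
    obtain L where L: "L \<in> Bs" "x \<in> L" "m \<in> L" "{C \<in> Bs. x \<in> C \<and> m \<in> C} = {L}"
      using line_singleton[OF x m(1)] m(2) by auto
    obtain K where K: "K \<in> Bs" "m \<in> K" "y \<in> K" "{C \<in> Bs. m \<in> C \<and> y \<in> C} = {K}"
      using line_singleton[OF m(1) y(1)] m(3) by auto
    have "potential Bs {x} {} = 17"
      using potential_insert[of x "{}" "{}"] card_blocks r[OF x] v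
      by (simp add: potential_empty potential_at_empty)
    \<comment> \<open>Both \<open>m\<close> and \<open>y\<close> have weight 5, so these terms
      cancel and only the line through \<open>m\<close> and \<open>y\<close> is lost.\<close>
    then have common: "potential Bs {m, x} {y} + potential_common {x} {} m y = 17"
      using potential_round[of m "{x}" y "{}"] at_x m y by simp
    have common_eq: "potential_common {x} {} m y = 2 ^ card (K \<inter> {x})"
      unfolding potential_common_def live_def using K(4) by simp
    show "breaker_wins_from X Bs {m, x} {y}"
    proof (cases "y \<in> L")
      case True
      then have "K = L"
        using line_unique[OF K(1) L(1) m(3)] K L by blast
      then have "potential Bs {m, x} {y} < 16"
        using common common_eq L by simp
      then show ?thesis
        by (rule breaker_wins_from_potential) (use m y in auto)
    next
      case False
      then have "x \<notin> K"
        using line_unique[OF K(1) L(1) m(2)] K L by blast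
      then have P: "potential Bs {m, x} {y} = 16"
        using common common_eq by simp
      have "card (L - {m, x}) = 2"
        using L m card_block[OF L(1)] by (simp add: card_Diff_subset)
      then obtain z where "z \<in> L - {m, x}"
        by (metis card.empty ex_in_conv zero_neq_numeral)
      then have z: "z \<in> L" "z \<in> X" "z \<noteq> m" "z \<noteq> x" "z \<noteq> y"
        using False block_subset[OF L(1)] by auto
      \<comment> \<open>Of the four blocks through \<open>p\<close>, only the one joining it to
        \<open>y\<close> is dead.\<close>
      have live_card: "card {B \<in> live Bs {y}. p \<in> B} = 3" if p: "p \<in> X" "p \<noteq> y" for p
      proof -
        obtain J where J: "J \<in> Bs" "p \<in> J" "y \<in> J" "{C \<in> Bs. p \<in> C \<and> y \<in> C} = {J}"
          using line_singleton[OF p(1) y(1) p(2)] by auto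
        then have "{B \<in> live Bs {y}. p \<in> B} = {B \<in> Bs. p \<in> B} - {J}"
          by (auto simp: live_def)
        then show ?thesis
          using J r[OF p(1)] by (simp add: card_Diff_singleton)
      qed
      \<comment> \<open>The line \<open>L\<close> contributes 4, and each of the two other live
        blocks through \<open>z\<close> at least 1.\<close>
      have "6 \<le> potential_at Bs {m, x} {y} z"
      proof -
        let ?Z = "{B \<in> live Bs {y}. z \<in> B}"
        have LZ: "L \<in> ?Z"
          using L z False by (simp add: live_def)
        have "L \<inter> {m, x} = {m, x}"
          using L by blast
        then have "potential_at Bs {m, x} {y} z = 4 + (\<Sum>B\<in>?Z - {L}. 2 ^ card (B \<inter> {m, x}))"
          unfolding potential_at_def using LZ finite_live m(2) by (subst sum.remove[of _ L]) auto
        moreover have "(\<Sum>B\<in>?Z - {L}. 1) \<le> (\<Sum>B\<in>?Z - {L}. 2 ^ card (B \<inter> {m, x}) :: nat)"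
          by (intro sum_mono) simp
        moreover have "card (?Z - {L}) = 2"
          using live_card[OF z(2,5)] LZ by (simp add: card_Diff_singleton)
        ultimately show ?thesis by simp
      qed
      then have Pz: "potential Bs {m, x} {z, y} \<le> 10"
        using potential_remove[of "{m, x}" "{y}" z] P by simp
      show ?thesis
      proof (rule breaker_wins_from.move)
        show "\<forall>B\<in>Bs. \<not> B \<subseteq> {m, x}"
          by (rule small) (simp_all add: card_insert_if)
        show "z \<in> X - {m, x} - {y}"
          using z by simp
        fix w assume "w \<in> X - {m, x} - insert z {y}"
        then have w: "w \<in> X" "w \<noteq> m" "w \<noteq> x" "w \<noteq> y" "w \<noteq> z"
          by auto
        let ?W = "{B \<in> live Bs {z, y}. w \<in> B}"
        have finW: "finite ?W"
          using finite_live by simp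
        \<comment> \<open>The point \<open>z\<close> has killed \<open>L\<close>, the only block
          containing both \<open>x\<close> and \<open>m\<close>.\<close>
        have weight: "2 ^ card (B \<inter> {m, x}) \<le> 1 + (if x \<in> B then 1 else 0) + (if m \<in> B then 1 else 0::nat)"
          if B: "B \<in> ?W" for B
        proof -
          have "\<not> (x \<in> B \<and> m \<in> B)"
            using B L(4) z by (auto simp: live_def)
          then show ?thesis
            by (cases "x \<in> B"; cases "m \<in> B") auto
        qed
        have one: "card {B \<in> ?W. p \<in> B} \<le> 1" if p: "p \<in> X" "p \<noteq> w" for p
        proof -
          obtain J where "{C \<in> Bs. w \<in> C \<and> p \<in> C} = {J}"
            using line_singleton[OF w(1) p(1)] p(2) by auto
          then have "{B \<in> ?W. p \<in> B} \<subseteq> {J}"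
            by (auto simp: live_def)
          then show ?thesis
            using card_mono[of "{J}"] by force
        qed
        have "finite {B \<in> live Bs {y}. w \<in> B}"
          using finite_live by simp
        then have "card ?W \<le> card {B \<in> live Bs {y}. w \<in> B}"
          by (rule card_mono) (auto simp: live_def)
        then have "card ?W \<le> 3"
          using live_card[OF w(1,4)] by simp
        have count: "(\<Sum>B\<in>?W. if P B then 1 else 0) = card {B \<in> ?W. P B}" for P
          using sum.inter_filter[OF finW, of "\<lambda>_. 1::nat" P] by simp
        have "potential_at Bs {m, x} {z, y} w
            \<le> (\<Sum>B\<in>?W. 1 + (if x \<in> B then 1 else 0) + (if m \<in> B then 1 else 0))"
          unfolding potential_at_def by (intro sum_mono weight)
        also have "\<dots> = card ?W + card {B \<in> ?W. x \<in> B} + card {B \<in> ?W. m \<in> B}"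
          by (simp only: sum.distrib count card_eq_sum)
        also have "\<dots> \<le> 5"
          using \<open>card ?W \<le> 3\<close> one[OF x] one[OF m(1)] w by simp
        finally have "potential Bs {w, m, x} {z, y} < 16"
          using potential_insert[of w "{m, x}" "{z, y}"] Pz w by simp
        then show "breaker_wins_from X Bs (insert w {m, x}) {z, y}"
          by (rule breaker_wins_from_potential) (use m y z w in auto)
      qed
    qed
  qed (rule small, simp_all)
qed

end

lemma four_uniform_linearI:
  assumes "BIBD v 4 1 X Bs"
  shows "four_uniform_linear X Bs"
proof
  have single: "\<exists>B. {B \<in> Bs. x \<in> B \<and> y \<in> B} = {B}" if "x \<in> X" "y \<in> X" "x \<noteq> y" for x y
    using assms that by (auto simp: BIBD_def card_1_singleton_iff)
  show "finite X"
    using assms by (simp add: BIBD_def)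
  show sub: "B \<subseteq> X" if "B \<in> Bs" for B
    using assms that by (simp add: BIBD_def)
  show "card B = 4" if "B \<in> Bs" for B
    using assms that by (simp add: BIBD_def)
  show "\<exists>B\<in>Bs. x \<in> B \<and> y \<in> B" if "x \<in> X" "y \<in> X" "x \<noteq> y" for x y
    using single[OF that] by blast
  show "B = C"
    if "B \<in> Bs" "C \<in> Bs" "x \<noteq> y" "x \<in> B" "y \<in> B" "x \<in> C" "y \<in> C" for B C x y
  proof -
    have "x \<in> X" "y \<in> X"
      using that sub by auto
    then obtain D where D: "{B \<in> Bs. x \<in> B \<and> y \<in> B} = {D}"
      using single \<open>x \<noteq> y\<close> by blast
    have "B \<in> {B \<in> Bs. x \<in> B \<and> y \<in> B}" "C \<in> {B \<in> Bs. x \<in> B \<and> y \<in> B}"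
      using that by simp_all
    then show ?thesis
      unfolding D by simp
  qed
qed

section \<open>Forcing sequences on residual blocks\<close>

text \<open>If \<open>a\<close> is not free, then it is Maker's or does not lie on \<open>B\<close>,
  since \<open>B\<close> avoids \<open>N\<close>; the block is then already complete.\<close>

lemma maker_wins_from_one_missing:
  assumes "B \<in> Bs" "B \<subseteq> X" "B \<inter> N = {}" "B \<subseteq> insert a M"
  shows "maker_wins_from X Bs M N"
proof (cases "a \<in> X - M - N")
  case True
  then show ?thesis
  proof (rule maker_wins_from.move)
    show "\<exists>B\<in>Bs. B \<subseteq> insert a M"
      using assms by blast
    show "maker_wins_from X Bs (insert a M) (insert y N)" for y
      using assms(1,4) by (rule maker_wins_from.full)
  qed
next
  case False
  then have "B \<subseteq> M"
    using assms(2-4) by blast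
  then show ?thesis
    by (rule maker_wins_from.full[OF assms(1)])
qed

text \<open>
  The lists in \<open>H\<close> contain the points that Maker still needs to complete certain blocks.
\<close>

definition residual :: "'a set set \<Rightarrow> 'a set \<Rightarrow> 'a set \<Rightarrow> 'a list list \<Rightarrow> bool" where
  "residual Bs M N H \<longleftrightarrow> (\<forall>l\<in>set H. \<exists>B\<in>Bs. B \<inter> N = {} \<and> B \<subseteq> M \<union> set l)"

definition maker_takes :: "'a \<Rightarrow> 'a list list \<Rightarrow> 'a list list" where
  "maker_takes x H = map (removeAll x) H"

definition breaker_takes :: "'a \<Rightarrow> 'a list list \<Rightarrow> 'a list list" where
  "breaker_takes y H = filter (\<lambda>l. y \<notin> set l) H"

lemma residual_maker_takes:
  "residual Bs M N H \<Longrightarrow> residual Bs (insert x M) N (maker_takes x H)"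
  unfolding residual_def
proof
  fix l assume H: "\<forall>l\<in>set H. \<exists>B\<in>Bs. B \<inter> N = {} \<and> B \<subseteq> M \<union> set l"
    and "l \<in> set (maker_takes x H)"
  then obtain l' where l': "l' \<in> set H" "set l = set l' - {x}"
    by (auto simp: maker_takes_def)
  then obtain B where "B \<in> Bs" "B \<inter> N = {}" "B \<subseteq> M \<union> set l'"
    using H by blast
  then show "\<exists>B\<in>Bs. B \<inter> N = {} \<and> B \<subseteq> insert x M \<union> set l"
    using l'(2) by blast
qed

lemma residual_breaker_takes:
  assumes "residual Bs M N H" "y \<notin> M"
  shows "residual Bs M (insert y N) (breaker_takes y H)"
  unfolding residual_def
proof
  fix l assume "l \<in> set (breaker_takes y H)"
  then have l: "l \<in> set H" "y \<notin> set l"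
    by (auto simp: breaker_takes_def)
  then obtain B where "B \<in> Bs" "B \<inter> N = {}" "B \<subseteq> M \<union> set l"
    using assms(1) unfolding residual_def by blast
  then show "\<exists>B\<in>Bs. B \<inter> insert y N = {} \<and> B \<subseteq> M \<union> set l"
    using l(2) assms(2) by blast
qed

lemma maker_wins_from_residual_short:
  assumes "\<And>B. B \<in> Bs \<Longrightarrow> B \<subseteq> X" "residual Bs M N H" "l \<in> set H" "length l \<le> 1"
  shows "maker_wins_from X Bs M N"
proof -
  obtain B where B: "B \<in> Bs" "B \<inter> N = {}" "B \<subseteq> M \<union> set l"
    using assms(2,3) unfolding residual_def by blast
  have "\<exists>a. set l \<subseteq> {a}"
    using assms(4) by (cases l) auto
  then obtain a where "B \<subseteq> insert a M"
    using B(3) by blast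
  then show ?thesis
    using maker_wins_from_one_missing[OF B(1) assms(1)[OF B(1)] B(2)] by blast
qed

text \<open>
  Maker to move wins within \<open>n\<close> further moves, each threatening to complete a block, before
  the completing one.
\<close>

fun forced_win :: "nat \<Rightarrow> 'a list list \<Rightarrow> bool" where
  "forced_win 0 H = list_ex (\<lambda>l. length l \<le> 1) H"
| "forced_win (Suc n) H = list_ex (\<lambda>l. case l of
      [a, b] \<Rightarrow> forced_win n (breaker_takes b (maker_takes a H)) \<or>
                forced_win n (breaker_takes a (maker_takes b H))
    | _ \<Rightarrow> length l \<le> 1) H"

text \<open>After Maker takes \<open>a\<close>, every reply other than \<open>b\<close> lets Maker
  complete the block at once. If \<open>a\<close> is not free, only \<open>b\<close> can be
  missing.\<close>

lemma maker_wins_from_threat: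
  assumes blocks: "\<And>B. B \<in> Bs \<Longrightarrow> B \<subseteq> X"
    and B: "B \<in> Bs" "B \<inter> N = {}" "B \<subseteq> M \<union> {a, b}"
    and answered: "b \<in> X - insert a M - N \<Longrightarrow> maker_wins_from X Bs (insert a M) (insert b N)"
  shows "maker_wins_from X Bs M N"
proof (cases "a \<in> X - M - N")
  case True
  then show ?thesis
  proof (rule maker_wins_from.move)
    assume "X - insert a M - N = {}"
    then have "B \<subseteq> insert a M"
      using B blocks[OF B(1)] by blast
    then show "\<exists>B\<in>Bs. B \<subseteq> insert a M"
      using B(1) by blast
  next
    fix y assume y: "y \<in> X - insert a M - N"
    show "maker_wins_from X Bs (insert a M) (insert y N)"
    proof (cases "y = b")
      case True
      then show ?thesis using answered y by simp
    next
      case False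
      then have "B \<inter> insert y N = {}"
        using B y by blast
      then show ?thesis
        using maker_wins_from_one_missing[OF B(1) blocks[OF B(1)]] B(3) by blast
    qed
  qed
next
  case False
  then have "B \<subseteq> insert b M"
    using B blocks[OF B(1)] by blast
  then show ?thesis
    using maker_wins_from_one_missing[OF B(1) blocks[OF B(1)] B(2)] by blast
qed

lemma maker_wins_from_forced_win:
  assumes blocks: "\<And>B. B \<in> Bs \<Longrightarrow> B \<subseteq> X"
  shows "residual Bs M N H \<Longrightarrow> forced_win n H \<Longrightarrow> maker_wins_from X Bs M N"
proof (induction n arbitrary: M N H)
  case 0
  then show ?case
    using maker_wins_from_residual_short[OF blocks 0(1)] by (auto simp: list_ex_iff)
next
  case (Suc n)
  obtain l where l: "l \<in> set H" "case l of
      [a, b] \<Rightarrow> forced_win n (breaker_takes b (maker_takes a H)) \<or>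
                forced_win n (breaker_takes a (maker_takes b H))
    | _ \<Rightarrow> length l \<le> 1"
    using Suc.prems(2) by (auto simp: list_ex_iff)
  \<comment> \<open>The two orders of playing a pair merge into one case, because only
    \<open>set l\<close> is fixed.\<close>
  then consider "length l \<le> 1"
    | a b where "set l = {a, b}" "forced_win n (breaker_takes b (maker_takes a H))"
    by (auto split: list.splits)
  then show ?case
  proof cases
    case 1
    then show ?thesis
      using maker_wins_from_residual_short[OF blocks Suc.prems(1) l(1)] by blast
  next
    case (2 a b)
    obtain B where B: "B \<in> Bs" "B \<inter> N = {}" "B \<subseteq> M \<union> {a, b}"
      using Suc.prems(1) l(1) 2(1) unfolding residual_def by metis
    show ?thesis
    proof (rule maker_wins_from_threat[where Bs = Bs, OF _ B])
      show "C \<subseteq> X" if "C \<in> Bs" for C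
        using blocks that .
      assume "b \<in> X - insert a M - N"
      then show "maker_wins_from X Bs (insert a M) (insert b N)"
        using Suc.IH residual_breaker_takes[OF residual_maker_takes[OF Suc.prems(1)]] 2(2) by blast
    qed
  qed
qed

text \<open>
  \<open>plan\<close> maps Breaker's replies so far, the latest first, to Maker's next free move; where it is
  undefined, a forcing sequence is searched.
\<close>

primrec plan_wins ::
  "('a list \<Rightarrow> 'a option) \<Rightarrow> nat \<Rightarrow> 'a list \<Rightarrow> 'a list \<Rightarrow> 'a list list \<Rightarrow> bool" where
  "plan_wins plan 0 ys U H = forced_win 4 H"
| "plan_wins plan (Suc d) ys U H = (case plan ys of
      None \<Rightarrow> forced_win 4 H
    | Some x \<Rightarrow> let U' = removeAll x U in
        x \<in> set U \<and> U' \<noteq> [] \<and>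
        list_all (\<lambda>y. plan_wins plan d (y # ys) (removeAll y U')
                       (breaker_takes y (maker_takes x H))) U')"

text \<open>Soundness for an arbitrary \<open>plan\<close>: a table found by search enters only
  through the executable check. The list \<open>U\<close> stands for the free points, so that all
  replies can be enumerated.\<close>

lemma maker_wins_from_plan_wins:
  assumes blocks: "\<And>B. B \<in> Bs \<Longrightarrow> B \<subseteq> X"
  shows "residual Bs M N H \<Longrightarrow> set U = X - M - N \<Longrightarrow> plan_wins plan d ys U H \<Longrightarrow>
    maker_wins_from X Bs M N"
proof (induction d arbitrary: M N H U ys)
  case 0
  then show ?case
    using maker_wins_from_forced_win[OF blocks] by auto
next
  case (Suc d)
  show ?case
  proof (cases "plan ys")
    case None
    then show ?thesis
      using Suc.prems maker_wins_from_forced_win[OF blocks] by auto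
  next
    case (Some x)
    have U': "set (removeAll x U) = X - insert x M - N"
      using Suc.prems(2) by auto
    have "x \<in> set U" "set (removeAll x U) \<noteq> {}"
      using Suc.prems(3) Some unfolding set_empty by (simp_all add: Let_def)
    then have x: "x \<in> X - M - N" "X - insert x M - N \<noteq> {}"
      unfolding Suc.prems(2) U' .
    show ?thesis
    proof (rule maker_wins_from.move[OF x(1)])
      fix y assume y: "y \<in> X - insert x M - N"
      then have "plan_wins plan d (y # ys) (removeAll y (removeAll x U))
          (breaker_takes y (maker_takes x H))"
        using Suc.prems(3) Some unfolding U'[symmetric] by (simp add: Let_def list_all_iff)
      then show "maker_wins_from X Bs (insert x M) (insert y N)"
        using y Suc.prems(2) residual_breaker_takes[OF residual_maker_takes[OF Suc.prems(1)]]
        by (intro Suc.IH) auto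
    qed (use x(2) in blast)
  qed
qed

section \<open>The affine plane of order 4\<close>

text \<open>
  The number \<open>4 * i + j\<close> stands for row \<open>j\<close> of column \<open>i\<close>: the lists are the four columns, the four
  rows, and the graphs of the even permutations of \<open>{0, 1, 2, 3}\<close>.
\<close>

definition affine_lines :: "nat list list" where
  "affine_lines =
    [[0, 1, 2, 3], [4, 5, 6, 7], [8, 9, 10, 11], [12, 13, 14, 15],
     [0, 4, 8, 12], [1, 5, 9, 13], [2, 6, 10, 14], [3, 7, 11, 15],
     [0, 5, 10, 15], [0, 6, 11, 13], [0, 7, 9, 14], [1, 4, 11, 14],
     [1, 6, 8, 15], [1, 7, 10, 12], [2, 4, 9, 15], [2, 5, 11, 12],
     [2, 7, 8, 13], [3, 4, 10, 13], [3, 5, 8, 14], [3, 6, 9, 12]]"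

text \<open>
  Found by computer search. Maker holds point 0, Breaker point 4.
\<close>

definition affine_plan :: "nat list \<Rightarrow> nat option" where
  "affine_plan = map_of
    [([], 1), ([2], 9), ([5, 2], 6), ([14, 2], 8), ([3], 10), ([5, 3], 6), ([12, 3], 11),
     ([5], 6), ([2, 5], 7), ([3, 5], 7), ([6], 5), ([7], 5), ([8], 5), ([9], 6), ([10], 6),
     ([11], 5), ([12], 5), ([13], 7), ([14], 5), ([15], 7)]"

text \<open>Injectivity of \<open>f\<close> keeps free points free, and a completed block of
  \<open>Cs\<close> is mapped to a completed block of \<open>Bs\<close>.\<close>

lemma maker_wins_from_image:
  assumes "maker_wins_from Y Cs M N"
    and f: "bij_betw f Y X" and blocks: "\<And>C. C \<in> Cs \<Longrightarrow> f ` C \<in> Bs"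
    and "M \<subseteq> Y" "N \<subseteq> Y"
  shows "maker_wins_from X Bs (f ` M) (f ` N)"
  using assms(1,4,5)
proof induction
  case (full B M N)
  then show ?case
    using blocks by (intro maker_wins_from.full[of "f ` B"]) auto
next
  case (move x M N)
  have X: "X = f ` Y" and inj: "inj_on f Y"
    using f by (auto simp: bij_betw_def)
  have rest: "X - insert (f x) (f ` M) - f ` N = f ` (Y - insert x M - N)"
    using move.hyps(1) move.prems inj unfolding X by (auto simp: inj_on_def)
  show ?case
  proof (rule maker_wins_from.move[of "f x"])
    show "f x \<in> X - f ` M - f ` N"
      using move.hyps(1) move.prems inj unfolding X by (auto simp: inj_on_def)
  next
    assume "X - insert (f x) (f ` M) - f ` N = {}"
    then have "Y - insert x M - N = {}"
      unfolding rest by simp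
    then obtain C where "C \<in> Cs" "C \<subseteq> insert x M"
      using move.hyps(2) by blast
    then show "\<exists>B\<in>Bs. B \<subseteq> insert (f x) (f ` M)"
      using blocks by (intro bexI[of _ "f ` C"]) auto
  next
    fix y assume "y \<in> X - insert (f x) (f ` M) - f ` N"
    then obtain z where "z \<in> Y - insert x M - N" "y = f z"
      unfolding rest by blast
    then show "maker_wins_from X Bs (insert (f x) (f ` M)) (insert y (f ` N))"
      using move.IH[of z] move.hyps(1) move.prems by auto
  qed
qed

text \<open>Evaluation of the whole game tree. Depth 3 suffices because the keys of
  \<open>affine_plan\<close> record at most two replies.\<close>

lemma affine_plan_wins:
  "plan_wins affine_plan 3 [] (removeAll 4 (removeAll 0 [0..<16]))
    (breaker_takes 4 (maker_takes 0 affine_lines))"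
  by code_simp

lemma maker_wins_from_affine:
  "maker_wins_from {..<16} (set ` set affine_lines) {0} {4}"
proof (rule maker_wins_from_plan_wins[OF _ _ _ affine_plan_wins])
  show "B \<subseteq> {..<16}" if "B \<in> set ` set affine_lines" for B
    using that by (auto simp: affine_lines_def)
  have "residual (set ` set affine_lines) {} {} affine_lines"
    by (auto simp: residual_def)
  then show "residual (set ` set affine_lines) {0} {4}
      (breaker_takes 4 (maker_takes 0 affine_lines))"
    by (intro residual_breaker_takes residual_maker_takes) simp_all
  show "set (removeAll 4 (removeAll 0 [0..<16])) = {..<16} - {0} - {4::nat}"
    by auto
qed

context four_uniform_linear
begin

section \<open>Parallel classes in a design on 16 points\<close>

definition parallel :: "'a set \<Rightarrow> 'a set \<Rightarrow> bool" where
  "parallel l m \<longleftrightarrow> l = m \<or> l \<inter> m = {}"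

lemma parallel_refl: "parallel l l"
  by (simp add: parallel_def)

lemma parallel_sym: "parallel l m \<Longrightarrow> parallel m l"
  by (auto simp: parallel_def)

text \<open>Five blocks pass through \<open>p\<close>. If \<open>p\<close> is off \<open>l\<close>,
  four of them join it to the points of \<open>l\<close>, and the fifth is the parallel.\<close>

lemma parallel_through:
  assumes v: "card X = 16" and l: "l \<in> Bs" and p: "p \<in> X"
  shows "\<exists>!m. m \<in> Bs \<and> p \<in> m \<and> parallel m l"
proof (cases "p \<in> l")
  case True
  then show ?thesis
    using l by (auto simp: parallel_def)
next
  case False
  have "\<forall>q\<in>l. \<exists>B. B \<in> Bs \<and> p \<in> B \<and> q \<in> B"
    using line_ex[OF p] block_subset[OF l] False by blast
  then obtain J where J: "\<And>q. q \<in> l \<Longrightarrow> J q \<in> Bs \<and> p \<in> J q \<and> q \<in> J q"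
    by metis
  have inj: "inj_on J l"
  proof (rule inj_onI, rule ccontr)
    fix q q' assume q: "q \<in> l" "q' \<in> l" "J q = J q'" "q \<noteq> q'"
    then have "J q = l"
      using line_unique[OF _ l q(4)] J by metis
    then show False
      using J[OF q(1)] False by simp
  qed
  have sub: "J ` l \<subseteq> {B \<in> Bs. p \<in> B}"
    using J by blast
  have "card {B \<in> Bs. p \<in> B} = 5"
    using card_blocks_through[OF p] v by simp
  then have "card ({B \<in> Bs. p \<in> B} - J ` l) = 1"
    using card_image[OF inj] card_block[OF l] sub finite_block[OF l] by (simp add: card_Diff_subset)
  then obtain m where m: "{B \<in> Bs. p \<in> B} - J ` l = {m}"
    by (auto simp: card_1_singleton_iff)
  have "B \<in> J ` l \<longleftrightarrow> B \<inter> l \<noteq> {}" if B: "B \<in> Bs" "p \<in> B" for B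
  proof
    show "B \<inter> l \<noteq> {}" if "B \<in> J ` l"
      using that J by blast
    assume "B \<inter> l \<noteq> {}"
    then obtain q where q: "q \<in> B" "q \<in> l"
      by blast
    then have "p \<noteq> q"
      using False by blast
    then have "B = J q"
      using line_unique[OF B(1) _ _ B(2) q(1)] J[OF q(2)] by blast
    then show "B \<in> J ` l"
      using q(2) by blast
  qed
  then have "{B \<in> Bs. p \<in> B \<and> B \<inter> l = {}} = {B \<in> Bs. p \<in> B} - J ` l"
    by blast
  then have "{B \<in> Bs. p \<in> B \<and> B \<inter> l = {}} = {m}"
    unfolding m .
  moreover have "B \<in> Bs \<and> p \<in> B \<and> parallel B l \<longleftrightarrow> B \<in> {B \<in> Bs. p \<in> B \<and> B \<inter> l = {}}" for B
    using False by (auto simp: parallel_def)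
  ultimately show ?thesis
    by (metis singleton_iff)
qed

text \<open>If \<open>l\<close> and \<open>n\<close> share a point, both are the unique parallel to
  \<open>m\<close> through it.\<close>

lemma parallel_trans:
  assumes v: "card X = 16" and "l \<in> Bs" "m \<in> Bs" "n \<in> Bs" "parallel l m" "parallel m n"
  shows "parallel l n"
proof (rule ccontr)
  assume non: "\<not> parallel l n"
  then obtain p where p: "p \<in> l" "p \<in> n"
    by (auto simp: parallel_def)
  then have "p \<in> X"
    using block_subset assms(2) by blast
  then have "l = n"
    using parallel_through[OF v assms(3)] assms(2,4-6) p parallel_sym[OF assms(6)] by blast
  then show False
    using non by (simp add: parallel_def)
qed

section \<open>Grid coordinates from two parallel classes\<close>

lemma enumerate_block:
  assumes "B \<in> Bs" "p \<in> B" "q \<in> B" "p \<noteq> q"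
  obtains x where "x 0 = p" "x 1 = q" "bij_betw x {..<4::nat} B"
proof -
  have "card (B - {p, q}) = 2"
    using assms card_block by (simp add: card_Diff_subset)
  then obtain c d where cd: "B - {p, q} = {c, d}" "c \<noteq> d"
    by (auto simp: card_2_iff)
  then have "c \<notin> {p, q}" "d \<notin> {p, q}" "B = {p, q, c, d}"
    using assms by blast+
  then have "bij_betw ((!) [p, q, c, d]) {..<4} B"
    using cd(2) assms(4) by (intro bij_betw_nth) auto
  then show ?thesis
    by (rule that[rotated 2]) simp_all
qed

text \<open>The first index is the column and the second the row.\<close>

definition grid :: "(nat \<Rightarrow> nat \<Rightarrow> 'a) \<Rightarrow> bool" where
  "grid P \<longleftrightarrow>
     (\<forall>i<4. \<forall>j<4. \<forall>i'<4. \<forall>j'<4. P i j = P i' j' \<longrightarrow> i = i' \<and> j = j') \<and>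
     (\<forall>i<4. P i ` {..<4} \<in> Bs) \<and> (\<forall>j<4. (\<lambda>i. P i j) ` {..<4} \<in> Bs)"

text \<open>Two lines \<open>l\<close> and \<open>m\<close> through \<open>a\<close> serve as axes,
  with \<open>b\<close> on \<open>l\<close>. The parallels to \<open>m\<close> through the points of
  \<open>l\<close> are the columns, the parallels to \<open>l\<close> through the points of
  \<open>m\<close> the rows, and \<open>P i j\<close> is their intersection.\<close>

lemma grid_exists:
  assumes v: "card X = 16" and a: "a \<in> X" "b \<in> X" "a \<noteq> b"
  obtains P where "grid P" "P 0 0 = a" "P 1 0 = b"
proof -
  obtain l where l: "l \<in> Bs" "a \<in> l" "b \<in> l"
    using line_ex[OF a] by blast
  have "\<not> X \<subseteq> l"
  proof
    assume "X \<subseteq> l"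
    then have "card X \<le> card l"
      by (rule card_mono[OF finite_block[OF l(1)]])
    then show False
      using card_block[OF l(1)] v by simp
  qed
  then obtain c where c: "c \<in> X" "c \<notin> l"
    by blast
  then have "a \<noteq> c"
    using l by blast
  then obtain m where m: "m \<in> Bs" "a \<in> m" "c \<in> m"
    using line_ex[OF a(1) c(1)] by blast
  obtain x where x: "x 0 = a" "x 1 = b" "bij_betw x {..<4::nat} l"
    using enumerate_block[OF l a(3)] by blast
  obtain y where y: "y 0 = a" "y 1 = c" "bij_betw y {..<4::nat} m"
    using enumerate_block[OF m \<open>a \<noteq> c\<close>] by blast
  have xl: "x i \<in> l" and ym: "y i \<in> m" if "i < 4" for i
    using x(3) y(3) that by (auto simp: bij_betw_def)
  have xinj: "i = j" if "i < 4" "j < 4" "x i = x j" for i j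
    using x(3) that by (auto simp: bij_betw_def inj_on_def)
  have yinj: "i = j" if "i < 4" "j < 4" "y i = y j" for i j
    using y(3) that by (auto simp: bij_betw_def inj_on_def)
  have "\<forall>i\<in>{..<4}. \<exists>B. B \<in> Bs \<and> x i \<in> B \<and> parallel B m"
    using parallel_through[OF v m(1)] xl block_subset[OF l(1)] by blast
  then obtain C where C: "\<And>i. i < 4 \<Longrightarrow> C i \<in> Bs \<and> x i \<in> C i \<and> parallel (C i) m"
    by (metis lessThan_iff)
  have "\<forall>j\<in>{..<4}. \<exists>B. B \<in> Bs \<and> y j \<in> B \<and> parallel B l"
    using parallel_through[OF v l(1)] ym block_subset[OF m(1)] by blast
  then obtain R where R: "\<And>j. j < 4 \<Longrightarrow> R j \<in> Bs \<and> y j \<in> R j \<and> parallel (R j) l"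
    by (metis lessThan_iff)
  have lm: "\<not> parallel l m"
    using l(2) m(2,3) c(2) by (auto simp: parallel_def)
  have CR: "\<not> parallel (C i) (R j)" if ij: "i < 4" "j < 4" for i j
  proof
    assume "parallel (C i) (R j)"
    then have "parallel (C i) l"
      using parallel_trans[OF v _ _ l(1)] C[OF ij(1)] R[OF ij(2)] by blast
    then have "parallel l m"
      using parallel_trans[OF v l(1) _ m(1)] parallel_sym C[OF ij(1)] by blast
    then show False
      using lm by simp
  qed
  then have "\<forall>i\<in>{..<4}. \<forall>j\<in>{..<4}. \<exists>p. p \<in> C i \<inter> R j"
    by (auto simp: parallel_def)
  then obtain P where P: "\<And>i j. i < 4 \<Longrightarrow> j < 4 \<Longrightarrow> P i j \<in> C i \<and> P i j \<in> R j"
    by (metis IntE lessThan_iff)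
  have Puniq: "P i j = p" if "i < 4" "j < 4" "p \<in> C i" "p \<in> R j" for i j p
    using line_unique[of "C i" "R j" "P i j" p] C R P CR that parallel_refl by metis
  \<comment> \<open>Two meeting columns would coincide, contain two points of \<open>l\<close> and
    so equal \<open>l\<close>, which is not parallel to \<open>m\<close>.\<close>
  have Cinj: "i = i'" if i: "i < 4" "i' < 4" "C i \<inter> C i' \<noteq> {}" for i i'
  proof (rule ccontr)
    assume "i \<noteq> i'"
    then have ne: "x i \<noteq> x i'"
      using xinj i by blast
    have "parallel (C i) (C i')"
      using parallel_trans[OF v _ m(1)] C i parallel_sym by blast
    then have "C i = C i'"
      using i(3) by (auto simp: parallel_def)
    then have "C i = l"
      using line_unique[OF _ l(1) ne] C[OF i(1)] C[OF i(2)] xl i by metis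
    then show False
      using C[OF i(1)] lm by metis
  qed
  have Rinj: "j = j'" if j: "j < 4" "j' < 4" "R j \<inter> R j' \<noteq> {}" for j j'
  proof (rule ccontr)
    assume "j \<noteq> j'"
    then have ne: "y j \<noteq> y j'"
      using yinj j by blast
    have "parallel (R j) (R j')"
      using parallel_trans[OF v _ l(1)] R j parallel_sym by blast
    then have "R j = R j'"
      using j(3) by (auto simp: parallel_def)
    then have "R j = m"
      using line_unique[OF _ m(1) ne] R[OF j(1)] R[OF j(2)] ym j by metis
    then show False
      using R[OF j(1)] lm parallel_sym by metis
  qed
  have Pinj: "i = i' \<and> j = j'" if "i < 4" "j < 4" "i' < 4" "j' < 4" "P i j = P i' j'" for i j i' j'
    using P[OF that(1,2)] P[OF that(3,4)] that Cinj[of i i'] Rinj[of j j'] by auto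
  have line_eq: "f ` {..<4::nat} = B" if "B \<in> Bs" "inj_on f {..<4}" "f ` {..<4} \<subseteq> B" for f B
    using that card_image[OF that(2)] card_block finite_block by (intro card_subset_eq) auto
  have "P i ` {..<4} = C i" if "i < 4" for i
    using P Pinj C that by (intro line_eq inj_onI) auto
  moreover have "(\<lambda>i. P i j) ` {..<4} = R j" if "j < 4" for j
    using P Pinj R that by (intro line_eq inj_onI) auto
  ultimately have "grid P"
    unfolding grid_def using Pinj C R by simp
  moreover have "C 0 = m"
    using parallel_through[OF v m(1) a(1)] C[of 0] x(1) m parallel_refl by auto
  moreover have "R 0 = l"
    using parallel_through[OF v l(1) a(1)] R[of 0] y(1) l parallel_refl by auto
  ultimately show ?thesis
    using that Puniq[of 0 0 a] Puniq[of 1 0 b] C[of 1] x(2) l m by simp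
qed


lemma grid_inj:
  assumes "grid P" "i < 4" "j < 4" "i' < 4" "j' < 4" "P i j = P i' j'"
  shows "i = i'" "j = j'"
  using assms unfolding grid_def by blast+

lemma grid_column: "grid P \<Longrightarrow> i < 4 \<Longrightarrow> P i ` {..<4} \<in> Bs"
  by (simp add: grid_def)

lemma grid_row: "grid P \<Longrightarrow> j < 4 \<Longrightarrow> (\<lambda>i. P i j) ` {..<4} \<in> Bs"
  by (simp add: grid_def)

lemma grid_in_points: "grid P \<Longrightarrow> i < 4 \<Longrightarrow> j < 4 \<Longrightarrow> P i j \<in> X"
  using grid_column[of P i] block_subset[of "P i ` {..<4}"] by blast

text \<open>The block joining the two points is neither a row nor a column. A missed column would
  make it parallel to column \<open>i\<close>, which it meets; so it has one point in every column,
  and these lie in distinct rows.\<close>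

lemma grid_transversal:
  assumes v: "card X = 16" and P: "grid P"
    and ij: "i < 4" "j < 4" "i' < 4" "j' < 4" "i \<noteq> i'" "j \<noteq> j'"
  obtains s where "\<And>k. k < 4 \<Longrightarrow> s k < 4" "inj_on s {..<4}" "s i = j" "s i' = j'"
    "(\<lambda>k. P k (s k)) ` {..<4} \<in> Bs"
proof -
  have "P i j \<noteq> P i' j'"
    using grid_inj(1)[OF P ij(1-4)] ij(5) by blast
  then obtain B where B: "B \<in> Bs" "P i j \<in> B" "P i' j' \<in> B"
    using line_ex[OF grid_in_points[OF P ij(1,2)] grid_in_points[OF P ij(3,4)]] by blast
  have column: "B \<noteq> P k ` {..<4}" if "k < 4" for k
  proof
    assume "B = P k ` {..<4}"
    then obtain t t' where "t < 4" "P i j = P k t" "t' < 4" "P i' j' = P k t'"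
      using B(2,3) by blast
    then show False
      using grid_inj(1)[OF P ij(1,2) that] grid_inj(1)[OF P ij(3,4) that] ij(5) by blast
  qed
  have row: "B \<noteq> (\<lambda>k. P k t) ` {..<4}" if "t < 4" for t
  proof
    assume "B = (\<lambda>k. P k t) ` {..<4}"
    then obtain k k' where "k < 4" "P i j = P k t" "k' < 4" "P i' j' = P k' t"
      using B(2,3) by blast
    then show False
      using grid_inj(2)[OF P ij(1,2) _ that] grid_inj(2)[OF P ij(3,4) _ that] ij(6) by blast
  qed
  have "\<exists>t<4. P k t \<in> B" if k: "k < 4" for k
  proof (rule ccontr)
    assume "\<not> ?thesis"
    then have "parallel B (P k ` {..<4})"
      by (auto simp: parallel_def)
    moreover have "parallel (P k ` {..<4}) (P i ` {..<4})"
      using grid_inj(1)[OF P] k ij(1) by (cases "k = i") (auto simp: parallel_def)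
    ultimately have "parallel B (P i ` {..<4})"
      using parallel_trans[OF v B(1) grid_column[OF P k] grid_column[OF P ij(1)]] by blast
    then show False
      using column[OF ij(1)] B(2) ij(2) by (auto simp: parallel_def)
  qed
  then obtain s where s: "\<And>k. k < 4 \<Longrightarrow> s k < 4 \<and> P k (s k) \<in> B"
    by metis
  have on_column: "s k = t" if "k < 4" "t < 4" "P k t \<in> B" for k t
  proof (rule ccontr)
    assume "s k \<noteq> t"
    then have "P k (s k) \<noteq> P k t"
      using grid_inj(2)[OF P] that s by blast
    then have "B = P k ` {..<4}"
      using line_unique[OF B(1) grid_column[OF P that(1)]] s[OF that(1)] that by blast
    then show False
      using column[OF that(1)] by blast
  qed
  have inj: "inj_on s {..<4}"
  proof (rule inj_onI, rule ccontr)
    fix k k' assume k: "k \<in> {..<4}" "k' \<in> {..<4}" "s k = s k'" "k \<noteq> k'"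
    then have "P k (s k) \<noteq> P k' (s k)"
      using grid_inj(1)[OF P] s by (metis lessThan_iff)
    moreover have "P k' (s k) \<in> B"
      using s[of k'] k by simp
    ultimately have "B = (\<lambda>i. P i (s k)) ` {..<4}"
      using line_unique[OF B(1) grid_row[OF P, of "s k"]] s[of k] k by blast
    then show False
      using row s k by blast
  qed
  have "inj_on (\<lambda>k. P k (s k)) {..<4}"
    using grid_inj(1)[OF P] s by (intro inj_onI) (metis lessThan_iff)
  then have "(\<lambda>k. P k (s k)) ` {..<4} = B"
    using s card_block[OF B(1)] finite_block[OF B(1)]
    by (intro card_subset_eq) (auto simp: card_image)
  then show ?thesis
    using that[of s] s inj on_column B ij by blast
qed

lemma lessThan_4: "{..<4::nat} = {0, 1, 2, 3}"
  by auto

text \<open>The rows are permuted by the block through \<open>P 0 0\<close> and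
  \<open>P 1 1\<close>, which then becomes the diagonal. Row 0 stays in place, so \<open>a\<close>
  and \<open>b\<close> keep their coordinates.\<close>

lemma grid_with_diagonal_exists:
  assumes v: "card X = 16" and a: "a \<in> X" "b \<in> X" "a \<noteq> b"
  obtains P where "grid P" "P 0 0 = a" "P 1 0 = b" "{P 0 0, P 1 1, P 2 2, P 3 3} \<in> Bs"
proof -
  obtain P where P: "grid P" "P 0 0 = a" "P 1 0 = b"
    using grid_exists[OF v a] .
  obtain s where s: "\<And>k. k < 4 \<Longrightarrow> s k < (4::nat)" "inj_on s {..<4::nat}" "s 0 = 0" "s 1 = 1"
    "(\<lambda>k. P k (s k)) ` {..<4} \<in> Bs"
    by (rule grid_transversal[OF v P(1), of 0 0 1 1]) auto
  have surj: "s ` {..<4} = {..<4}"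
    using s(1,2) by (intro card_subset_eq) (auto simp: card_image)
  define Q where "Q i j = P i (s j)" for i j
  have "grid Q"
    unfolding grid_def
  proof (intro conjI allI impI)
    fix i j i' j' assume ij: "i < 4" "j < 4" "i' < (4::nat)" "j' < (4::nat)" "Q i j = Q i' j'"
    then have "i = i'" "s j = s j'"
      using grid_inj[OF P(1), of i "s j" i' "s j'"] s(1) unfolding Q_def by blast+
    then show "i = i'" "j = j'"
      using s(2) ij by (auto simp: inj_on_def)
  next
    fix i :: nat assume "i < 4"
    have "Q i ` {..<4} = P i ` s ` {..<4}"
      by (simp add: Q_def image_image)
    then show "Q i ` {..<4} \<in> Bs"
      using grid_column[OF P(1) \<open>i < 4\<close>] by (simp add: surj)
  next
    fix j :: nat assume "j < 4"
    then show "(\<lambda>i. Q i j) ` {..<4} \<in> Bs"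
      using grid_row[OF P(1) s(1)] by (simp add: Q_def)
  qed
  moreover have "{Q 0 0, Q 1 1, Q 2 2, Q 3 3} \<in> Bs"
    using s(5) by (simp add: Q_def lessThan_4)
  ultimately show ?thesis
    using that[of Q] P(2,3) s(3) by (simp add: Q_def)
qed

text \<open>
  The block through \<open>P i0 j0\<close> and \<open>P i1 j2\<close> has two candidates, and the one that is the graph of an
  odd permutation relative to the given block would meet that block in two points. As three-cycles
  generate the alternating group, this determines all blocks from the diagonal.
\<close>

lemma grid_three_cycle:
  assumes v: "card X = 16" and P: "grid P"
    and B: "{P i0 j0, P i1 j1, P i2 j2, P i3 j3} \<in> Bs"
    and i: "{i0, i1, i2, i3} = {..<4}" "distinct [i0, i1, i2, i3]"
    and j: "{j0, j1, j2, j3} = {..<4}" "distinct [j0, j1, j2, j3]"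
  shows "{P i0 j0, P i1 j2, P i2 j3, P i3 j1} \<in> Bs"
proof -
  have lt: "i0 < 4" "i1 < 4" "i2 < 4" "i3 < 4" "j0 < 4" "j1 < 4" "j2 < 4" "j3 < 4"
    using i(1) j(1) by blast+
  obtain s where s: "\<And>k. k < 4 \<Longrightarrow> s k < (4::nat)" "inj_on s {..<4}" "s i0 = j0" "s i1 = j2"
    "(\<lambda>k. P k (s k)) ` {..<4} \<in> Bs"
    using grid_transversal[OF v P lt(1,5,2,7)] i(2) j(2) by auto
  let ?C = "{P i0 j0, P i1 j2, P i2 (s i2), P i3 (s i3)}"
  have C: "?C \<in> Bs"
    using s(3-5) unfolding i(1)[symmetric] by simp
  have "s i2 \<in> {j0, j1, j2, j3}" "s i3 \<in> {j0, j1, j2, j3}"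
    unfolding j(1) using s(1) lt by auto
  moreover have "s i2 \<noteq> j0" "s i2 \<noteq> j2" "s i3 \<noteq> j0" "s i3 \<noteq> j2" "s i2 \<noteq> s i3"
    using s(2-4) lt i(2) by (auto simp: inj_on_def)
  moreover have "s i3 \<noteq> j3"
  proof
    assume "s i3 = j3"
    moreover have "P i0 j0 \<noteq> P i3 j3"
      using grid_inj(1)[OF P lt(1,5,4,8)] i(2) by auto
    ultimately have "?C = {P i0 j0, P i1 j1, P i2 j2, P i3 j3}"
      by (intro line_unique[OF C B]) auto
    then have "P i1 j2 \<in> {P i0 j0, P i1 j1, P i2 j2, P i3 j3}"
      by blast
    then show False
      using grid_inj[OF P lt(2,7) lt(1,5)] grid_inj[OF P lt(2,7) lt(2,6)]
        grid_inj[OF P lt(2,7) lt(3,7)] grid_inj[OF P lt(2,7) lt(4,8)] i(2) j(2) by auto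
  qed
  ultimately have "s i2 = j3" "s i3 = j1"
    by auto
  then show ?thesis
    using C by simp
qed

lemma affine_coordinates:
  assumes v: "card X = 16" and a: "a \<in> X" "b \<in> X" "a \<noteq> b"
  obtains f where "bij_betw f {..<16::nat} X" "f 0 = a" "f 4 = b"
    "\<And>l. l \<in> set affine_lines \<Longrightarrow> f ` set l \<in> Bs"
proof -
  obtain P where P: "grid P" "P 0 0 = a" "P 1 0 = b" and diag: "{P 0 0, P 1 1, P 2 2, P 3 3} \<in> Bs"
    using grid_with_diagonal_exists[OF v a] .
  note cycle = grid_three_cycle[OF v P(1)]
  \<comment> \<open>Each diagonal point is fixed in turn; exchanging two of the other three points
    gives both three-cycles.\<close>
  have c3: "{P 0 0, P 1 2, P 2 3, P 3 1} \<in> Bs" "{P 0 0, P 1 3, P 2 1, P 3 2} \<in> Bs"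
    "{P 0 2, P 1 1, P 2 3, P 3 0} \<in> Bs" "{P 0 3, P 1 1, P 2 0, P 3 2} \<in> Bs"
    "{P 0 1, P 1 3, P 2 2, P 3 0} \<in> Bs" "{P 0 3, P 1 0, P 2 2, P 3 1} \<in> Bs"
    "{P 0 1, P 1 2, P 2 0, P 3 3} \<in> Bs" "{P 0 2, P 1 0, P 2 1, P 3 3} \<in> Bs"
    using cycle[of 0 0 1 1 2 2 3 3] cycle[of 0 0 1 1 3 3 2 2]
      cycle[of 1 1 0 0 2 2 3 3] cycle[of 1 1 0 0 3 3 2 2]
      cycle[of 2 2 0 0 1 1 3 3] cycle[of 2 2 0 0 3 3 1 1]
      cycle[of 3 3 0 0 1 1 2 2] cycle[of 3 3 0 0 2 2 1 1] diag
    by (simp_all add: insert_commute lessThan_4)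
  \<comment> \<open>The double transpositions arise from the first of these blocks by fixing one of
    its points other than \<open>P 0 0\<close>.\<close>
  have c22: "{P 0 1, P 1 0, P 2 3, P 3 2} \<in> Bs" "{P 0 2, P 1 3, P 2 0, P 3 1} \<in> Bs"
    "{P 0 3, P 1 2, P 2 1, P 3 0} \<in> Bs"
    using cycle[of 2 3 0 0 3 1 1 2] cycle[of 3 1 0 0 1 2 2 3] cycle[of 1 2 0 0 2 3 3 1] c3(1)
    by (simp_all add: insert_commute lessThan_4)
  define f where "f n = P (n div 4) (n mod 4)" for n
  have "inj_on f {..<16}"
  proof (rule inj_onI)
    fix m n :: nat assume mn: "m \<in> {..<16}" "n \<in> {..<16}" "f m = f n"
    then have "m div 4 = n div 4" "m mod 4 = n mod 4"
      using grid_inj[OF P(1), of "m div 4" "m mod 4" "n div 4" "n mod 4"]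
      by (auto simp: f_def)
    then show "m = n"
      by (metis div_mult_mod_eq)
  qed
  moreover have "f ` {..<16} \<subseteq> X"
    using grid_in_points[OF P(1)] by (auto simp: f_def)
  ultimately have "bij_betw f {..<16} X"
    using card_subset_eq[OF finite_points] v by (simp add: bij_betw_def card_image)
  moreover have "f ` set l \<in> Bs" if "l \<in> set affine_lines" for l
    using that c3 c22 diag grid_column[OF P(1)] grid_row[OF P(1)]
    by (auto simp: affine_lines_def f_def lessThan_4)
  moreover have "f 0 = a" "f 4 = b"
    using P by (simp_all add: f_def)
  ultimately show ?thesis
    using that by blast
qed


text \<open>Coordinates can be chosen after Breaker's reply, with Maker's opening as 0 and the reply
  as 4, so the single position searched covers all openings.\<close>

lemma maker_wins_from_start_16:
  assumes v: "card X = 16"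
  shows "maker_wins_from X Bs {} {}"
proof -
  have reply: "maker_wins_from X Bs {a} {b}" if ab: "a \<in> X" "b \<in> X" "a \<noteq> b" for a b
  proof -
    obtain f where f: "bij_betw f {..<16::nat} X" "f 0 = a" "f 4 = b"
      "\<And>l. l \<in> set affine_lines \<Longrightarrow> f ` set l \<in> Bs"
      using affine_coordinates[OF v ab] by blast
    have "maker_wins_from X Bs (f ` {0}) (f ` {4})"
      by (rule maker_wins_from_image[OF maker_wins_from_affine f(1)]) (use f(4) in auto)
    then show ?thesis
      using f(2,3) by simp
  qed
  have "X \<noteq> {}"
    using v by auto
  then obtain a where a: "a \<in> X"
    by blast
  show ?thesis
  proof (rule maker_wins_from.move)
    show "a \<in> X - {} - {}"
      using a by simp
    have "card (X - {a}) = 15"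
      using a v by simp
    then have "X - {a} \<noteq> {}"
      by (metis card.empty zero_neq_numeral)
    then show "\<exists>B\<in>Bs. B \<subseteq> {a}" if "X - {a} - {} = {}"
      using that by simp
    show "maker_wins_from X Bs {a} {b}" if "b \<in> X - {a} - {}" for b
      using reply[of a b] a that by auto
  qed
qed

text \<open>The congruence leaves only 1, 4 and 13 points up to 13, and above that 16 or at least
  25.\<close>

lemma game_outcome:
  assumes "X \<noteq> {}"
  shows "if card X > 13 then maker_has_winning_strategy X Bs else breaker_has_winning_strategy X Bs"
proof -
  have mod: "card X mod 12 = 1 \<or> card X mod 12 = 4"
    using card_points_mod_12[OF assms] by simp
  show ?thesis
  proof (cases "card X > 13")
    case True
    then have "card X = 16 \<or> card X \<ge> 25"
      using mod by presburger
    then show ?thesis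
      using True maker_wins_from_start_16 maker_wins_from_start maker_has_winning_strategyI by auto
  next
    case False
    then have "card X \<le> 4 \<or> card X = 13"
      using mod by presburger
    then show ?thesis
      using False assms breaker_wins_from_first_move_small breaker_wins_from_first_move_13
      by (auto intro: breaker_has_winning_strategyI)
  qed
qed

end

theorem theorem2p3:
  fixes v :: nat and X :: "'a set" and Bs :: "'a set set"
  assumes "v > 0"
    and "BIBD v 4 1 X Bs"
  shows "(maker_has_winning_strategy X Bs \<longleftrightarrow> v mod 12 \<in> {1, 4} \<and> v > 13) \<and>
         (v \<in> {4, 13} \<longrightarrow> breaker_has_winning_strategy X Bs)"
proof -
  interpret four_uniform_linear X Bs
    using assms(2) by (rule four_uniform_linearI)
  have v: "card X = v" and X: "X \<noteq> {}"
    using assms by (auto simp: BIBD_def)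
  show ?thesis
  \<comment> \<open>The residue condition follows from the existence of the design, so only the size
    of \<open>v\<close> decides.\<close>
  proof (cases "v > 13")
    case True
    then show ?thesis
      using game_outcome[OF X] card_points_mod_12[OF X] v by auto
  next
    case False
    then show ?thesis
      using game_outcome[OF X] not_both_winning_strategies[OF finite_points] v by auto
  qed
qed

end
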